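(* Let $A\in M_n(\mathbb{R}_+)$ and let $1\le k<n$. Then $conv_\otimes\big(\sigma_{trop}^k(A)\big)\subseteq W_{\max}^k(A)$.
   Context: $\mathbb{R}_+$ is the set of nonnegative reals, $M_{m\times n}(\mathbb{R}_+)$ the set of $m\times n$ matrices with nonnegative real entries, $M_n(\mathbb{R}_+)=M_{n\times n}(\mathbb{R}_+)$. Max algebra: $a\oplus b=\max\{a,b\}$, $(A\oplus B)_{ij}=\max\{a_{ij},b_{ij}\}$, $(A\otimes B)_{ij}=\max_l a_{il}b_{lj}$; $tr_\otimes(A)=\max_i a_{ii}$. The max $k$-numerical range: $W_{\max}^k(A)=\{tr_\otimes(X^t\otimes A\otimes X): X\in M_{n\times k}(\mathbb{R}_+),\ X^t\otimes X=I_k\}$. The max permanent is $perm(A)=\max_{\sigma}a_{1\sigma(1)}\cdots a_{n\sigma(n)}$ over all permutations $\sigma$ of $\{1,\dots,n\}$. The characteristic maxpolynomial of $A$ is the function $\mathcal{X}_A(x)=perm(xI\oplus A)$, $x\in[0,\infty)$. It can be written uniquely (up to order) as $\mathcal{X}_A(x)=(x\oplus\lambda_1)(x\oplus\lambda_2)\cdots(x\oplus\lambda_n)$ for all $x\ge 0$, with $\lambda_i\ge0$; the numbers $\lambda_1,\dots,\lambda_n$ are the algebraic max (tropical) eigenvalues of $A$ counted with tropical multiplicities, and $\sigma_{trop}(A)$ is the set of them. The $k$-tropical max spectrum is $\sigma_{trop}^k(A)=\{\max_{1\le j\le k}\lambda_{i_j}: 1\le i_1<\cdots<i_k\le n\}$.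 For $M\subseteq\mathbb{R}_+$, the max convex hull is $conv_\otimes(M)=\{\bigoplus_{i=1}^m\alpha_ix_i: m\in\mathbb{N},\ x_i\in M,\ \alpha_i\ge0,\ \bigoplus_{i=1}^m\alpha_i=1\}$. *)

theory Defs
  imports
    Complex_Main
    "HOL-Combinatorics.Permutations"
    "Jordan_Normal_Form.Matrix"
begin

(* Matrices and lists are indexed from 0, so the index set {1..n} becomes {..<n}. *)

definition nonneg_carrier_mat :: "nat \<Rightarrow> nat \<Rightarrow> real mat set" where
  "nonneg_carrier_mat m n = {A \<in> carrier_mat m n. \<forall>i<m. \<forall>j<n. 0 \<le> A $$ (i, j)}"

definition max_add :: "real mat \<Rightarrow> real mat \<Rightarrow> real mat" where
  "max_add A B =
     mat (dim_row A) (dim_col A) (\<lambda>(i, j). max (A $$ (i, j)) (B $$ (i, j)))"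

(* Meaningful only for a nonzero inner dimension: otherwise Max is applied to the empty set. *)
definition max_mult :: "real mat \<Rightarrow> real mat \<Rightarrow> real mat" where
  "max_mult A B =
     mat (dim_row A) (dim_col B) (\<lambda>(i, j). Max ((\<lambda>l. A $$ (i, l) * B $$ (l, j)) ` {..<dim_col A}))"

definition max_trace :: "real mat \<Rightarrow> real" where
  "max_trace A = Max ((\<lambda>i. A $$ (i, i)) ` {..<dim_row A})"

(* The identity matrix of max algebra has the same entries 0 and 1 as the usual one. *)
definition max_numerical_range :: "nat \<Rightarrow> real mat \<Rightarrow> real set" where
  "max_numerical_range k A =
     {max_trace (max_mult (max_mult (transpose_mat X) A) X) | X.
        X \<in> nonneg_carrier_mat (dim_row A) k \<and> max_mult (transpose_mat X) X = 1\<^sub>m k}"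

definition max_perm :: "real mat \<Rightarrow> real" where
  "max_perm A =
     Max ((\<lambda>\<sigma>. \<Prod>i<dim_row A. A $$ (i, \<sigma> i)) ` {\<sigma>. \<sigma> permutes {..<dim_row A}})"

definition char_maxpoly :: "real mat \<Rightarrow> real \<Rightarrow> real" where
  "char_maxpoly A x = max_perm (max_add (x \<cdot>\<^sub>m 1\<^sub>m (dim_row A)) A)"

(* The factorization is unique up to order; sorting the list makes it unique.
   Each eigenvalue occurs in the list as often as its tropical multiplicity. *)
definition trop_eigenvalues :: "real mat \<Rightarrow> real list" where
  "trop_eigenvalues A =
     (THE ls. length ls = dim_row A \<and> sorted ls \<and> (\<forall>l \<in> set ls. 0 \<le> l) \<and>
        (\<forall>x\<ge>0. char_maxpoly A x = (\<Prod>i<dim_row A. max x (ls ! i))))"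

definition trop_spectrum :: "nat \<Rightarrow> real mat \<Rightarrow> real set" where
  "trop_spectrum k A =
     {Max ((\<lambda>i. trop_eigenvalues A ! i) ` I) | I. I \<subseteq> {..<dim_row A} \<and> card I = k}"

(* The number m of points must be positive, since an empty maximum is never 1 in
   nonnegative max algebra. *)
definition max_conv :: "real set \<Rightarrow> real set" where
  "max_conv M =
     {Max ((\<lambda>i. \<alpha> i * x i) ` {..<m}) | (m::nat) \<alpha> x.
        0 < m \<and> (\<forall>i<m. x i \<in> M \<and> 0 \<le> \<alpha> i) \<and> Max (\<alpha> ` {..<m}) = 1}"

end

theory Submission
  imports Defs
begin

text \<open>
  The max convex hull of a set of reals only contains points lying between two points of
  that set (\<open>max_conv_between\<close>), so it suffices to find, inside the max numerical range, every
  value between the least and the greatest element of the \<open>k\<close>-tropical spectrum. The max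
  numerical range turns out to contain every \<open>v\<close> for which some \<open>k\<close> diagonal entries of \<open>A\<close> are
  at most \<open>v\<close> while some entry of \<open>A\<close> is at least \<open>v\<close>
  (\<open>between_diagonal_and_entry_in_range\<close>): the columns of \<open>X\<close> have disjoint supports and
  maximum 1, so the \<open>k\<close> unit vectors at small diagonal entries are admissible, and since
  \<open>k < n\<close> there is a spare row; letting its weight grow from 0 to 1 moves the trace
  continuously from below \<open>v\<close> to above \<open>v\<close>.

  It remains to compare the tropical eigenvalues with the entries of \<open>A\<close>. No eigenvalue exceeds
  the largest entry, because beyond that entry the characteristic maxpolynomial is \<open>x ^ n\<close>
  (\<open>eigenvalue_le_some_entry\<close>). In the other direction, at most as many eigenvalues as
  diagonal entries are \<open>\<le> x\<close> (\<open>card_eigenvalues_le_card_diagonal\<close>): just to the right of \<open>x\<close>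
  the number of eigenvalues \<open>\<le> x\<close> is the exponent with which the product of the factors grows,
  whereas in the permanent only diagonal entries \<open>\<le> x\<close> can be overtaken by the variable.

  The eigenvalues are well defined by the fundamental theorem of max algebra for monic
  max-polynomials, whose two halves are \<open>maxpoly_factorization\<close> and \<open>factorization_unique\<close>.
\<close>

section \<open>Factorization of monic max-polynomials\<close>

text \<open>A max-polynomial is given by its set of terms, coefficient paired with degree. Several
  terms of the same degree are permitted, as they arise when a permanent is expanded: each
  choice of a permutation contributes its own terms.\<close>

definition maxpoly :: "(real \<times> nat) set \<Rightarrow> real \<Rightarrow> real" where
  "maxpoly P x = Max ((\<lambda>(c, m). c * x ^ m) ` P)"

definition monic_terms :: "nat \<Rightarrow> (real \<times> nat) set \<Rightarrow> bool" where
  "monic_terms n P \<longleftrightarrow> finite P \<and> (1, n) \<in> P \<and>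
     (\<forall>(c, m) \<in> P. 0 \<le> c \<and> m \<le> n \<and> (m = n \<longrightarrow> c \<le> 1))"

lemma maxpoly_eqI:
  assumes "finite P" and "(c, m) \<in> P" and "v = c * x ^ m"
    and "\<And>c m. (c, m) \<in> P \<Longrightarrow> c * x ^ m \<le> v"
  shows "maxpoly P x = v"
  unfolding maxpoly_def using assms by (intro Max_eqI) force+

lemma maxpoly_ge:
  assumes "finite P" and "(c, m) \<in> P"
  shows "c * x ^ m \<le> maxpoly P x"
  unfolding maxpoly_def using assms by (intro Max_ge) force+

lemma maxpoly_attained:
  assumes "finite P" and "P \<noteq> {}"
  obtains c m where "(c, m) \<in> P" and "maxpoly P x = c * x ^ m"
proof -
  have "maxpoly P x \<in> (\<lambda>(c, m). c * x ^ m) ` P"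
    unfolding maxpoly_def using assms by (intro Max_in) auto
  then show thesis using that by auto
qed

text \<open>The hypothesis on \<open>l\<close> says that the leading term already dominates every other term
  at \<open>x = l\<close>; having the highest degree, it does so at every larger \<open>x\<close> as well.\<close>

lemma maxpoly_beyond_largest_root:
  assumes P: "monic_terms n P" and le: "\<And>c m. (c, m) \<in> P \<Longrightarrow> c \<le> l ^ (n - m)"
    and "0 \<le> l" and "l \<le> x"
  shows "maxpoly P x = x ^ n"
proof (rule maxpoly_eqI)
  show "finite P" and "(1, n) \<in> P" using P by (auto simp: monic_terms_def)
  show "x ^ n = 1 * x ^ n" by simp
next
  fix c m assume cm: "(c, m) \<in> P"
  then have m: "m \<le> n" and c: "0 \<le> c" using P by (auto simp: monic_terms_def)
  have "c \<le> x ^ (n - m)"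
    using le[OF cm] power_mono[OF \<open>l \<le> x\<close> \<open>0 \<le> l\<close>] by (rule order_trans)
  then have "c * x ^ m \<le> x ^ (n - m) * x ^ m"
    using assms(3,4) by (intro mult_right_mono) auto
  also have "\<dots> = x ^ n" using m by (simp flip: power_add)
  finally show "c * x ^ m \<le> x ^ n" .
qed

text \<open>The largest root \<open>l\<close> is the last point where a term \<open>c0 * x ^ m0\<close> of lower degree meets
  \<open>x ^ n\<close>, that is, the maximum of the numbers \<open>root (n - m) c\<close>. To the right of \<open>l\<close> the
  leading term wins; to the left of it only the terms of degree at most \<open>m0\<close> matter, and these
  form \<open>c0 = l ^ (n - m0)\<close> times a monic max-polynomial of degree \<open>m0\<close>. So the factor
  \<open>max x l\<close> splits off \<open>n - m0\<close> times, and induction applies to what is left.\<close>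

lemma maxpoly_factorization:
  assumes "monic_terms n P"
  shows "\<exists>ls. length ls = n \<and> (\<forall>l \<in> set ls. 0 \<le> l) \<and>
           (\<forall>x\<ge>0. maxpoly P x = prod_list (map (max x) ls))"
  using assms
proof (induction n arbitrary: P rule: less_induct)
  case (less n)
  have fin: "finite P" and top: "(1, n) \<in> P"
    and P: "\<And>c m. (c, m) \<in> P \<Longrightarrow> 0 \<le> c \<and> m \<le> n \<and> (m = n \<longrightarrow> c \<le> 1)"
    using less.prems by (auto simp: monic_terms_def)
  define Q where "Q = {(c, m) \<in> P. m < n \<and> 0 < c}"
  have finQ: "finite Q" unfolding Q_def using fin by (auto intro: finite_subset)
  show ?case
  proof (cases "Q = {}")
    case True
    have "c \<le> 0 ^ (n - m)" if cm: "(c, m) \<in> P" for c m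
    proof (cases "m = n")
      case False
      moreover have "(c, m) \<notin> Q" using True by simp
      ultimately have "\<not> 0 < c" using P[OF cm] cm by (auto simp: Q_def)
      then show ?thesis by (simp add: power_0_left)
    qed (use P[OF cm] in simp)
    then have "maxpoly P x = x ^ n" if "0 \<le> x" for x
      using maxpoly_beyond_largest_root[OF less.prems] that by blast
    then show ?thesis
      by (intro exI[of _ "replicate n 0"]) auto
  next
    case False
    define h where "h = (\<lambda>(c::real, m). root (n - m) c)"
    define l where "l = Max (h ` Q)"
    have "l \<in> h ` Q" unfolding l_def using finQ False by (intro Max_in) auto
    then obtain c0 m0 where cm0: "(c0, m0) \<in> Q" and l: "l = root (n - m0) c0"
      by (auto simp: h_def)
    have m0: "m0 < n" and c0: "0 < c0" and cm0P: "(c0, m0) \<in> P" using cm0 by (auto simp: Q_def)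
    have lpos: "0 < l" using l m0 c0 by simp
    have c0l: "c0 = l ^ (n - m0)" using l m0 c0 by simp
    have bound: "c \<le> l ^ (n - m)" if cm: "(c, m) \<in> P" for c m
    proof (cases "(c, m) \<in> Q")
      case True
      then have "h (c, m) \<le> l" unfolding l_def using finQ by (intro Max_ge) auto
      moreover have "m < n" and "0 < c" using True by (auto simp: Q_def)
      ultimately have "root (n - m) c \<le> l" and "0 \<le> root (n - m) c"
        and "root (n - m) c ^ (n - m) = c" by (auto simp: h_def)
      then show ?thesis using power_mono[of "root (n - m) c" l "n - m"] by simp
    next
      case False
      then show ?thesis using cm P[OF cm] lpos
        by (cases "m = n") (auto simp: Q_def)
    qed
    \<comment> \<open>The terms surviving to the left of \<open>l\<close>, scaled to be monic. The bound by powers of \<open>l\<close>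
      passes to them, so their roots also are at most \<open>l\<close>.\<close>
    define P' where "P' = (\<lambda>(c, m). (c / c0, m)) ` {(c, m) \<in> P. m \<le> m0}"
    have finP': "finite P'" unfolding P'_def using fin by (auto intro: finite_subset)
    have topP': "(1, m0) \<in> P'" unfolding P'_def using cm0P c0 by force
    have boundP': "c \<le> l ^ (m0 - m)" if cm: "(c, m) \<in> P'" for c m
    proof -
      have m: "m \<le> m0" and "(c * c0, m) \<in> P" using cm c0 by (auto simp: P'_def)
      then have "c * c0 \<le> l ^ (n - m)" using bound by blast
      also have "\<dots> = l ^ (m0 - m) * c0" using m m0 by (simp add: c0l flip: power_add)
      finally show ?thesis using c0 by simp
    qed
    have "0 \<le> c \<and> m \<le> m0 \<and> (m = m0 \<longrightarrow> c \<le> 1)" if cm: "(c, m) \<in> P'" for c m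
      using boundP'[OF cm] cm P c0 by (auto simp: P'_def)
    then have monicP': "monic_terms m0 P'"
      using finP' topP' by (auto simp: monic_terms_def)
    then obtain ls where ls: "length ls = m0" "\<forall>l \<in> set ls. 0 \<le> l"
      "\<And>x. 0 \<le> x \<Longrightarrow> maxpoly P' x = prod_list (map (max x) ls)"
      using less.IH[OF m0] by blast
    have split: "maxpoly P x = max x l ^ (n - m0) * maxpoly P' x" if x: "0 \<le> x" for x
    proof (cases "l \<le> x")
      case True
      have "maxpoly P x = x ^ n"
        using maxpoly_beyond_largest_root[OF less.prems bound] lpos True by simp
      moreover have "maxpoly P' x = x ^ m0"
        using maxpoly_beyond_largest_root[OF monicP' boundP'] lpos True by simp
      ultimately show ?thesis using True m0 by (simp add: max_absorb1 flip: power_add)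
    next
      case False
      obtain c m where cm: "(c, m) \<in> P'" and att: "maxpoly P' x = c * x ^ m"
        using maxpoly_attained[OF finP'] topP' by blast
      have "maxpoly P x = c0 * maxpoly P' x"
      proof (rule maxpoly_eqI)
        show "finite P" by (rule fin)
        show "(c * c0, m) \<in> P" using cm c0 by (auto simp: P'_def)
        show "c0 * maxpoly P' x = c * c0 * x ^ m" using att by simp
      next
        fix c m assume cm: "(c, m) \<in> P"
        show "c * x ^ m \<le> c0 * maxpoly P' x"
        proof (cases "m \<le> m0")
          case True
          then have "(c / c0, m) \<in> P'" using cm by (force simp: P'_def)
          from maxpoly_ge[OF finP' this, of x] have "c / c0 * x ^ m \<le> maxpoly P' x" .
          then show ?thesis using c0 by (simp add: field_simps)
        next
          \<comment> \<open>Left of the largest root, the terms of degree above \<open>m0\<close> are dominated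
            by the term of degree \<open>m0\<close>.\<close>
          case False
          have "c * x ^ m \<le> l ^ (n - m) * x ^ m"
            using bound[OF cm] x by (intro mult_right_mono) auto
          also have "\<dots> = l ^ (n - m) * (x ^ (m - m0) * x ^ m0)"
            using False by (simp flip: power_add)
          also have "\<dots> \<le> l ^ (n - m) * (l ^ (m - m0) * x ^ m0)"
            using x lpos \<open>\<not> l \<le> x\<close> by (intro mult_left_mono mult_right_mono power_mono) auto
          also have "\<dots> = c0 * (1 * x ^ m0)"
            using P[OF cm] False by (simp add: c0l mult.assoc[symmetric] flip: power_add)
          also have "\<dots> \<le> c0 * maxpoly P' x"
            using maxpoly_ge[OF finP' topP', of x] c0 by (intro mult_left_mono) auto
          finally show ?thesis .
        qed
      qed
      then show ?thesis using False by (simp add: c0l max_absorb2)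
    qed
    show ?thesis
    proof (intro exI[of _ "replicate (n - m0) l @ ls"] conjI allI impI)
      show "length (replicate (n - m0) l @ ls) = n" using ls(1) m0 by simp
      show "\<forall>l\<in>set (replicate (n - m0) l @ ls). 0 \<le> l" using ls(2) lpos by auto
      show "maxpoly P x = prod_list (map (max x) (replicate (n - m0) l @ ls))" if "0 \<le> x" for x
        using split[OF that] ls(3)[OF that] by simp
    qed
  qed
qed

lemma prod_list_max_ge_power:
  fixes x :: real
  assumes "0 \<le> x"
  shows "x ^ length ls \<le> prod_list (map (max x) ls)"
proof (induction ls)
  case (Cons l ls)
  then show ?case using assms by (auto intro!: mult_mono simp: max_def)
qed simp

lemma prod_list_max_eq_power:
  fixes x :: real
  assumes "\<forall>l \<in> set ls. l \<le> x"
  shows "prod_list (map (max x) ls) = x ^ length ls"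
  using assms by (induction ls) (auto simp: max_absorb1)

lemma prod_list_max_gt_power:
  fixes x :: real
  assumes "0 < x" and "l \<in> set ls" and "x < l"
  shows "x ^ length ls < prod_list (map (max x) ls)"
  using assms(2)
proof (induction ls)
  case (Cons a ls)
  show ?case
  proof (cases "a = l")
    case True
    then have "x * x ^ length ls < max x a * x ^ length ls" using assms by simp
    also have "\<dots> \<le> max x a * prod_list (map (max x) ls)"
      using prod_list_max_ge_power[of x ls] assms by (intro mult_left_mono) auto
    finally show ?thesis by simp
  next
    case False
    then have "x ^ length ls < prod_list (map (max x) ls)" using Cons by simp
    then have "x * x ^ length ls < x * prod_list (map (max x) ls)" using assms by simp
    also have "\<dots> \<le> max x a * prod_list (map (max x) ls)"
      using \<open>x ^ length ls < _\<close> zero_less_power[OF assms(1), of "length ls"]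
      by (intro mult_right_mono) auto
    finally show ?thesis by simp
  qed
qed simp

text \<open>At a positive point \<open>x\<close> strictly between \<open>l\<close> and a larger \<open>m\<close>, the first product would
  be \<open>x ^ n\<close> and the second strictly more.\<close>

lemma largest_root_le:
  fixes l m :: real
  assumes "sorted (ls @ [l])" and "length ls = length ms" and "0 \<le> l"
    and "\<And>x. 0 < x \<Longrightarrow>
           prod_list (map (max x) (ls @ [l])) = prod_list (map (max x) (ms @ [m]))"
  shows "m \<le> l"
proof (rule ccontr)
  assume "\<not> m \<le> l"
  then obtain x where x: "l < x" "x < m" using dense[of l m] by auto
  then have "prod_list (map (max x) (ls @ [l])) = x ^ length (ls @ [l])"
    using assms(1) by (intro prod_list_max_eq_power) (auto simp: sorted_append)
  moreover have "x ^ length (ms @ [m]) < prod_list (map (max x) (ms @ [m]))"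
    using x assms(3) by (intro prod_list_max_gt_power[of _ m]) auto
  moreover have "0 < x" using x assms(3) by simp
  ultimately show False using assms(2) assms(4)[of x] by (metis length_append_singleton less_irrefl)
qed

text \<open>The two largest roots agree, and the corresponding factor can be cancelled. Cancelling
  needs the factor to be nonzero; this is why agreement is only required at positive
  arguments, where the induction hypothesis then asks for no more than what is known.\<close>

lemma factorization_unique:
  fixes ls ms :: "real list"
  assumes "length ls = length ms" and "sorted ls" and "sorted ms"
    and "\<forall>l \<in> set ls. 0 \<le> l" and "\<forall>l \<in> set ms. 0 \<le> l"
    and "\<And>x. 0 < x \<Longrightarrow> prod_list (map (max x) ls) = prod_list (map (max x) ms)"
  shows "ls = ms"
  using assms
proof (induction ls arbitrary: ms rule: rev_induct)
  case (snoc l ls)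
  obtain ms' m where ms: "ms = ms' @ [m]"
    using snoc.prems(1) by (cases ms rule: rev_cases) auto
  have "m \<le> l" using snoc.prems ms by (intro largest_root_le[of ls l ms' m]) auto
  moreover have "l \<le> m"
    using snoc.prems ms by (intro largest_root_le[of ms' m ls l]) auto
  ultimately have "l = m" by simp
  moreover have "ls = ms'"
  proof (rule snoc.IH)
    fix x :: real assume "0 < x"
    moreover then have "max x l \<noteq> 0" by auto
    ultimately show "prod_list (map (max x) ls) = prod_list (map (max x) ms')"
      using snoc.prems(6)[of x] ms \<open>l = m\<close> by simp
  qed (use snoc.prems ms in \<open>auto simp: sorted_append\<close>)
  ultimately show ?case using ms by simp
qed simp

section \<open>The characteristic maxpolynomial and its roots\<close>

text \<open>The diagonal of \<open>x \<otimes> I \<oplus> A\<close> carries \<open>max x\<close> and the rest carries \<open>max 0\<close>. Writing both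
  cases with one \<open>max\<close> makes the entrywise comparisons below uniform.\<close>

lemma char_maxpoly_eq:
  assumes "A \<in> carrier_mat n n"
  shows "char_maxpoly A x =
    Max ((\<lambda>\<sigma>. \<Prod>i<n. max (if i = \<sigma> i then x else 0) (A $$ (i, \<sigma> i))) ` {\<sigma>. \<sigma> permutes {..<n}})"
proof -
  have "(\<Prod>i<n. max_add (x \<cdot>\<^sub>m 1\<^sub>m n) A $$ (i, \<sigma> i)) =
        (\<Prod>i<n. max (if i = \<sigma> i then x else 0) (A $$ (i, \<sigma> i)))"
    if "\<sigma> permutes {..<n}" for \<sigma>
  proof (rule prod.cong)
    fix i assume "i \<in> {..<n}"
    then have "i < n" and "\<sigma> i < n" using permutes_in_image[OF that, of i] by auto
    then show "max_add (x \<cdot>\<^sub>m 1\<^sub>m n) A $$ (i, \<sigma> i) =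
        max (if i = \<sigma> i then x else 0) (A $$ (i, \<sigma> i))"
      by (simp add: max_add_def)
  qed simp
  then show ?thesis using assms
    by (auto simp: char_maxpoly_def max_perm_def max_add_def intro!: arg_cong[where f = Max] image_cong)
qed

lemma
  assumes "A \<in> carrier_mat n n"
  shows char_maxpoly_ge: "\<sigma> permutes {..<n} \<Longrightarrow>
      (\<Prod>i<n. max (if i = \<sigma> i then x else 0) (A $$ (i, \<sigma> i))) \<le> char_maxpoly A x"
    and char_maxpoly_attained: "\<exists>\<sigma>. \<sigma> permutes {..<n} \<and>
      char_maxpoly A x = (\<Prod>i<n. max (if i = \<sigma> i then x else 0) (A $$ (i, \<sigma> i)))"
proof -
  let ?F = "(\<lambda>\<sigma>. \<Prod>i<n. max (if i = \<sigma> i then x else 0) (A $$ (i, \<sigma> i))) ` {\<sigma>. \<sigma> permutes {..<n}}"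
  have fin: "finite ?F" by (simp add: finite_permutations)
  show "\<sigma> permutes {..<n} \<Longrightarrow>
      (\<Prod>i<n. max (if i = \<sigma> i then x else 0) (A $$ (i, \<sigma> i))) \<le> char_maxpoly A x"
    unfolding char_maxpoly_eq[OF assms] using fin by (intro Max_ge) auto
  have "id \<in> {\<sigma>. \<sigma> permutes {..<n}}" using permutes_id[of "{..<n}"] by simp
  then have "?F \<noteq> {}" by blast
  with fin have "Max ?F \<in> ?F" by (rule Max_in)
  then show "\<exists>\<sigma>. \<sigma> permutes {..<n} \<and>
      char_maxpoly A x = (\<Prod>i<n. max (if i = \<sigma> i then x else 0) (A $$ (i, \<sigma> i)))"
    unfolding char_maxpoly_eq[OF assms] by auto
qed

text \<open>Multiplying out \<open>max x (A $$ (i, i))\<close> over the fixed points of \<open>\<sigma>\<close> means choosing the set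
  \<open>S\<close> of fixed points at which the variable is taken.\<close>

definition char_terms :: "nat \<Rightarrow> real mat \<Rightarrow> (real \<times> nat) set" where
  "char_terms n A = (\<lambda>(\<sigma>, S). (\<Prod>i \<in> {..<n} - S. A $$ (i, \<sigma> i), card S)) `
     {(\<sigma>, S). \<sigma> permutes {..<n} \<and> S \<subseteq> {i. i < n \<and> \<sigma> i = i}}"

text \<open>Degree \<open>n\<close> forces \<open>S\<close> to be the whole index set, so the leading coefficient is an
  empty product.\<close>

lemma char_terms_monic:
  assumes "A \<in> nonneg_carrier_mat n n"
  shows "monic_terms n (char_terms n A)"
proof -
  have nonneg: "\<And>i j. i < n \<Longrightarrow> j < n \<Longrightarrow> 0 \<le> A $$ (i, j)"
    using assms by (auto simp: nonneg_carrier_mat_def)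
  have "{(\<sigma>, S). \<sigma> permutes {..<n} \<and> S \<subseteq> {i. i < n \<and> \<sigma> i = i}} \<subseteq>
        {\<sigma>. \<sigma> permutes {..<n}} \<times> Pow {..<n}" by auto
  then have fin: "finite (char_terms n A)"
    unfolding char_terms_def by (intro finite_imageI) (auto intro: finite_subset simp: finite_permutations)
  have top: "(1, n) \<in> char_terms n A"
    unfolding char_terms_def by (rule image_eqI[of _ _ "(id, {..<n})"]) (auto simp: permutes_id)
  have "0 \<le> (\<Prod>i \<in> {..<n} - S. A $$ (i, \<sigma> i)) \<and> card S \<le> n \<and>
        (card S = n \<longrightarrow> (\<Prod>i \<in> {..<n} - S. A $$ (i, \<sigma> i)) \<le> 1)"
    if \<sigma>: "\<sigma> permutes {..<n}" and S: "S \<subseteq> {i. i < n \<and> \<sigma> i = i}" for \<sigma> S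
  proof (intro conjI impI)
    show "0 \<le> (\<Prod>i \<in> {..<n} - S. A $$ (i, \<sigma> i))"
      using permutes_in_image[OF \<sigma>] nonneg by (intro prod_nonneg) auto
    have sub: "S \<subseteq> {..<n}" using S by auto
    then show "card S \<le> n" using card_mono[of "{..<n}" S] by simp
    assume "card S = n"
    then have "S = {..<n}" using sub by (intro card_subset_eq) auto
    then show "(\<Prod>i \<in> {..<n} - S. A $$ (i, \<sigma> i)) \<le> 1" by simp
  qed
  then show ?thesis using fin top by (auto simp: monic_terms_def char_terms_def)
qed

text \<open>For an optimal \<open>\<sigma>\<close>, the best choice is the set \<open>S\<close> of those fixed points at which \<open>x\<close>
  is at least the diagonal entry.\<close>

lemma char_maxpoly_eq_maxpoly:
  assumes A: "A \<in> nonneg_carrier_mat n n" and x: "0 \<le> x"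
  shows "char_maxpoly A x = maxpoly (char_terms n A) x"
proof -
  have C: "A \<in> carrier_mat n n" and nonneg: "\<And>i j. i < n \<Longrightarrow> j < n \<Longrightarrow> 0 \<le> A $$ (i, j)"
    using A by (auto simp: nonneg_carrier_mat_def)
  let ?M = "\<lambda>\<sigma> i. max (if i = \<sigma> i then x else 0) (A $$ (i, \<sigma> i))"
  have split: "(\<Prod>i \<in> {..<n} - S. A $$ (i, \<sigma> i)) * x ^ card S =
      (\<Prod>i<n. if i \<in> S then x else A $$ (i, \<sigma> i))" if "S \<subseteq> {..<n}" for S \<sigma>
  proof -
    have "(\<Prod>i<n. if i \<in> S then x else A $$ (i, \<sigma> i)) =
      (\<Prod>i \<in> {..<n} - S. if i \<in> S then x else A $$ (i, \<sigma> i)) *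
      (\<Prod>i \<in> S. if i \<in> S then x else A $$ (i, \<sigma> i))"
      using that by (intro prod.subset_diff) auto
    also have "\<dots> = (\<Prod>i \<in> {..<n} - S. A $$ (i, \<sigma> i)) * x ^ card S" by simp
    finally show ?thesis ..
  qed
  obtain \<sigma> where \<sigma>: "\<sigma> permutes {..<n}" and att: "char_maxpoly A x = (\<Prod>i<n. ?M \<sigma> i)"
    using char_maxpoly_attained[OF C] by blast
  define S where "S = {i. i < n \<and> \<sigma> i = i \<and> A $$ (i, i) \<le> x}"
  have "S \<subseteq> {..<n}" by (auto simp: S_def)
  have "maxpoly (char_terms n A) x = char_maxpoly A x"
  proof (rule maxpoly_eqI)
    show "finite (char_terms n A)" using char_terms_monic[OF A] by (simp add: monic_terms_def)
    show "(\<Prod>i \<in> {..<n} - S. A $$ (i, \<sigma> i), card S) \<in> char_terms n A"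
      unfolding char_terms_def by (rule image_eqI[of _ _ "(\<sigma>, S)"]) (auto simp: \<sigma> S_def)
    have "0 \<le> A $$ (i, \<sigma> i)" if "i < n" for i
      using permutes_in_image[OF \<sigma>, of i] nonneg that by auto
    then have "(\<Prod>i<n. ?M \<sigma> i) = (\<Prod>i<n. if i \<in> S then x else A $$ (i, \<sigma> i))"
      by (intro prod.cong) (auto simp: S_def max_def not_le intro: antisym dest: leD)
    then show "char_maxpoly A x = (\<Prod>i \<in> {..<n} - S. A $$ (i, \<sigma> i)) * x ^ card S"
      using split[of S \<sigma>] att \<open>S \<subseteq> {..<n}\<close> by simp
  next
    fix c m assume "(c, m) \<in> char_terms n A"
    then obtain \<tau> T where \<tau>: "\<tau> permutes {..<n}" and T: "T \<subseteq> {i. i < n \<and> \<tau> i = i}"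
      and cm: "c = (\<Prod>i \<in> {..<n} - T. A $$ (i, \<tau> i))" "m = card T"
      by (auto simp: char_terms_def)
    have "c * x ^ m = (\<Prod>i<n. if i \<in> T then x else A $$ (i, \<tau> i))"
      using split[of T \<tau>] T cm by auto
    also have "\<dots> \<le> (\<Prod>i<n. ?M \<tau> i)"
      using permutes_in_image[OF \<tau>] nonneg x T by (intro prod_mono) auto
    also have "\<dots> \<le> char_maxpoly A x" by (rule char_maxpoly_ge[OF C \<tau>])
    finally show "c * x ^ m \<le> char_maxpoly A x" .
  qed
  then show ?thesis ..
qed

lemma prod_list_max_conv_nth:
  "prod_list (map (max x) ls) = (\<Prod>i<length ls. max x (ls ! i))" for x :: real
  by (simp add: prod.list_conv_set_nth atLeast0LessThan)

text \<open>Existence and uniqueness of the factorization discharge the definite description in the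
  definition of the eigenvalue list.\<close>

lemma trop_eigenvalues_spec:
  assumes A: "A \<in> nonneg_carrier_mat n n"
  defines "ls \<equiv> trop_eigenvalues A"
  shows "length ls = n \<and> sorted ls \<and> (\<forall>l \<in> set ls. 0 \<le> l) \<and>
     (\<forall>x\<ge>0. char_maxpoly A x = (\<Prod>i<n. max x (ls ! i)))"
proof -
  have dim: "dim_row A = n" using A by (auto simp: nonneg_carrier_mat_def)
  let ?R = "\<lambda>ls. length ls = n \<and> sorted ls \<and> (\<forall>l \<in> set ls. 0 \<le> l) \<and>
     (\<forall>x\<ge>0. char_maxpoly A x = (\<Prod>i<n. max x (ls ! i)))"
  obtain ls0 where ls0: "length ls0 = n" "\<forall>l \<in> set ls0. 0 \<le> l"
    and fac: "\<And>x. 0 \<le> x \<Longrightarrow> maxpoly (char_terms n A) x = prod_list (map (max x) ls0)"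
    using maxpoly_factorization[OF char_terms_monic[OF A]] by blast
  have "prod_list (map (max x) (sort ls0)) = prod_list (map (max x) ls0)" for x
    by (simp flip: prod_mset_prod_list)
  then have "char_maxpoly A x = (\<Prod>i<n. max x (sort ls0 ! i))" if "0 \<le> x" for x
    using fac[OF that] char_maxpoly_eq_maxpoly[OF A that] ls0
      prod_list_max_conv_nth[of x "sort ls0"] by simp
  then have "?R (sort ls0)" using ls0 by simp
  moreover have "ms = sort ls0" if "?R ms" for ms
    using that \<open>?R (sort ls0)\<close>
    by (intro factorization_unique) (simp_all add: prod_list_max_conv_nth)
  ultimately have "?R (THE ls. ?R ls)" by (rule theI)
  then show ?thesis unfolding ls_def trop_eigenvalues_def dim .
qed

section \<open>Comparing eigenvalues with entries\<close>

text \<open>When the argument grows from \<open>z\<close> to \<open>y\<close>, a diagonal entry \<open>\<ge> y\<close> keeps hiding it, and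
  nothing changes off the diagonal. Hence in the product of any permutation only the
  factors at indices in \<open>S\<close> can grow, each at most by the ratio \<open>y / z\<close>.\<close>

lemma char_maxpoly_growth:
  assumes A: "A \<in> nonneg_carrier_mat n n" and z: "0 < z" and y: "z \<le> y"
    and gap: "\<And>i. i < n \<Longrightarrow> A $$ (i, i) < y \<Longrightarrow> i \<in> S" and S: "S \<subseteq> {..<n}"
  shows "char_maxpoly A y \<le> (y / z) ^ card S * char_maxpoly A z"
proof -
  have C: "A \<in> carrier_mat n n" and nonneg: "\<And>i j. i < n \<Longrightarrow> j < n \<Longrightarrow> 0 \<le> A $$ (i, j)"
    using A by (auto simp: nonneg_carrier_mat_def)
  let ?M = "\<lambda>\<sigma> x i. max (if i = \<sigma> i then x else 0) (A $$ (i, \<sigma> i))"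
  have r: "1 \<le> y / z" using z y by simp
  obtain \<sigma> where \<sigma>: "\<sigma> permutes {..<n}" and att: "char_maxpoly A y = (\<Prod>i<n. ?M \<sigma> y i)"
    using char_maxpoly_attained[OF C] by blast
  have "(\<Prod>i<n. ?M \<sigma> y i) \<le> (\<Prod>i<n. (if i \<in> S then y / z else 1) * ?M \<sigma> z i)"
  proof (rule prod_mono)
    fix i assume i: "i \<in> {..<n}"
    then have a: "0 \<le> A $$ (i, \<sigma> i)" using permutes_in_image[OF \<sigma>, of i] nonneg by auto
    have scale: "t \<le> y / z * t" if "0 \<le> t" for t
      using mult_right_mono[OF r that] by simp
    have yz: "y = y / z * z" using z by simp
    have "?M \<sigma> y i \<le> (if i \<in> S then y / z else 1) * ?M \<sigma> z i"
    proof (cases "i \<in> S")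
      case True
      have "?M \<sigma> y i \<le> max (y / z * (if i = \<sigma> i then z else 0)) (y / z * (A $$ (i, \<sigma> i)))"
        using scale[OF a] yz by (intro max.mono) auto
      also have "\<dots> = y / z * ?M \<sigma> z i"
        using r by (subst max_mult_distrib_left) (auto simp del: times_divide_eq_left)
      finally show ?thesis using True by simp
    next
      case False
      then show ?thesis using gap[of i] i by (auto simp: max_def)
    qed
    moreover have "0 \<le> ?M \<sigma> y i" using a by simp
    ultimately show "0 \<le> ?M \<sigma> y i \<and>
      ?M \<sigma> y i \<le> (if i \<in> S then y / z else 1) * ?M \<sigma> z i" by simp
  qed
  also have "\<dots> = (y / z) ^ card S * (\<Prod>i<n. ?M \<sigma> z i)"
    using S by (simp add: prod.distrib prod.If_cases Int_absorb1)
  also have "\<dots> \<le> (y / z) ^ card S * char_maxpoly A z"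
    using char_maxpoly_ge[OF C \<sigma>] z y by (intro mult_left_mono) auto
  finally show ?thesis using att by simp
qed

text \<open>Each eigenvalue \<open>\<le> x\<close> makes the product of the factors grow by the full ratio \<open>y / z\<close>
  between two points \<open>z < y\<close> to the right of \<open>x\<close>. If no diagonal entry lies strictly between
  \<open>x\<close> and \<open>y\<close>, then the previous lemma bounds this growth by one factor \<open>y / z\<close> for each
  diagonal entry \<open>\<le> x\<close>.\<close>

lemma card_eigenvalues_le_card_diagonal:
  assumes A: "A \<in> nonneg_carrier_mat n n" and x: "0 \<le> x"
  shows "card {i. i < n \<and> trop_eigenvalues A ! i \<le> x} \<le> card {i. i < n \<and> A $$ (i, i) \<le> x}"
proof -
  define ls where "ls = trop_eigenvalues A"
  have fac: "\<And>x. 0 \<le> x \<Longrightarrow> char_maxpoly A x = (\<Prod>i<n. max x (ls ! i))"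
    using trop_eigenvalues_spec[OF A] by (simp add: ls_def)
  define L where "L = {i. i < n \<and> ls ! i \<le> x}"
  define S where "S = {i. i < n \<and> A $$ (i, i) \<le> x}"
  \<comment> \<open>\<open>y\<close> is the next diagonal entry above \<open>x\<close>, unless \<open>x + 1\<close> is smaller or no such
    entry exists.\<close>
  define D where "D = insert (x + 1) {A $$ (i, i) | i. i < n \<and> x < A $$ (i, i)}"
  define y where "y = Min D"
  define z where "z = (x + y) / 2"
  have finD: "finite D" by (simp add: D_def)
  have "y \<in> D" unfolding y_def using finD by (intro Min_in) (auto simp: D_def)
  then have "x < y" by (auto simp: D_def)
  then have z: "x < z" "z < y" "0 < z" using x by (auto simp: z_def)
  have gap: "i \<in> S" if "i < n" and "A $$ (i, i) < y" for i
  proof (rule ccontr)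
    assume "i \<notin> S"
    then have "A $$ (i, i) \<in> D" using that by (auto simp: S_def D_def)
    then have "y \<le> A $$ (i, i)" unfolding y_def using finD by (intro Min_le)
    then show False using that by simp
  qed
  have pos: "0 < char_maxpoly A z"
    using fac[of z] z by (auto intro!: prod_pos)
  have "(y / z) ^ card L * char_maxpoly A z =
      (\<Prod>i<n. (if i \<in> L then y / z else 1) * max z (ls ! i))"
    using fac[of z] z by (simp add: prod.distrib prod.If_cases L_def Collect_conj_eq lessThan_def Int_absorb1)
  also have "\<dots> \<le> (\<Prod>i<n. max y (ls ! i))"
    using z by (intro prod_mono) (auto simp: L_def max_def)
  also have "\<dots> = char_maxpoly A y" using fac[of y] z by simp
  also have "\<dots> \<le> (y / z) ^ card S * char_maxpoly A z"
    using gap z by (intro char_maxpoly_growth[OF A]) (auto simp: S_def)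
  finally have "(y / z) ^ card L \<le> (y / z) ^ card S" using pos by simp
  moreover have "1 < y / z" using z by simp
  ultimately have "card L \<le> card S" by (simp add: power_le_imp_le_exp)
  then show ?thesis by (simp add: L_def S_def ls_def)
qed

text \<open>If every entry were below the eigenvalue \<open>l\<close>, then at a point \<open>x\<close> between the largest
  entry and \<open>l\<close> the permanent would be at most \<open>x ^ n\<close>, but the factor \<open>max x l\<close> makes the
  product larger than that.\<close>

lemma eigenvalue_le_some_entry:
  assumes A: "A \<in> nonneg_carrier_mat n n" and l: "l \<in> set (trop_eigenvalues A)"
  obtains p q where "p < n" and "q < n" and "l \<le> A $$ (p, q)"
proof (rule ccontr)
  note entry_thesis = that
  assume "\<not> thesis"
  then have less: "A $$ (p, q) < l" if pq: "p < n" "q < n" for p q 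
    using \<open>\<not> thesis\<close> entry_thesis[OF pq] by fastforce
  have C: "A \<in> carrier_mat n n" and nonneg: "\<And>i j. i < n \<Longrightarrow> j < n \<Longrightarrow> 0 \<le> A $$ (i, j)"
    using A by (auto simp: nonneg_carrier_mat_def)
  have len: "length (trop_eigenvalues A) = n" using trop_eigenvalues_spec[OF A] by simp
  then have n: "0 < n" using l by (cases n) auto
  define E where "E = (\<lambda>(p, q). A $$ (p, q)) ` ({..<n} \<times> {..<n})"
  have finE: "finite E" and "E \<noteq> {}" using n by (auto simp: E_def)
  then have "Max E < l" using less by (auto simp: E_def)
  then obtain x where x: "Max E < x" "x < l" using dense by blast
  have entry: "A $$ (p, q) \<le> x" if "p < n" "q < n" for p q
  proof -
    have "A $$ (p, q) \<in> E" using that by (force simp: E_def)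
    then have "A $$ (p, q) \<le> Max E" using finE by simp
    then show ?thesis using x by simp
  qed
  have "0 < x"
  proof -
    have "A $$ (0, 0) \<in> E" using n by (force simp: E_def)
    then have "A $$ (0, 0) \<le> Max E" using finE by simp
    then show ?thesis using x nonneg[OF n n] by simp
  qed
  obtain \<sigma> where \<sigma>: "\<sigma> permutes {..<n}"
    and att: "char_maxpoly A x = (\<Prod>i<n. max (if i = \<sigma> i then x else 0) (A $$ (i, \<sigma> i)))"
    using char_maxpoly_attained[OF C] by blast
  have "char_maxpoly A x \<le> (\<Prod>i<n. x)"
    unfolding att using permutes_in_image[OF \<sigma>] nonneg entry \<open>0 < x\<close>
    by (intro prod_mono) (auto simp: le_max_iff_disj)
  moreover have "x ^ n < char_maxpoly A x"
    using prod_list_max_gt_power[OF \<open>0 < x\<close> l \<open>x < l\<close>] trop_eigenvalues_spec[OF A] \<open>0 < x\<close>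
    by (simp add: prod_list_max_conv_nth)
  ultimately show False by simp
qed

section \<open>Elements of the max numerical range\<close>

text \<open>In nonnegative max algebra, \<open>transpose X \<otimes> X = I\<close> says that the columns of \<open>X\<close> have
  disjoint supports and maximum 1. Such an \<open>X\<close> is a colouring of the rows, naming the column
  in which a row may be nonzero, together with the weight found there. The trace then ranges
  over the pairs of rows of equal colour. Keeping the colouring fixed while the weights vary
  gives a trace over a fixed finite index set.\<close>

lemma coloured_weights_in_range:
  fixes w :: "nat \<Rightarrow> real" and col :: "nat \<Rightarrow> nat"
  assumes A: "A \<in> nonneg_carrier_mat n n" and k: "0 < k"
    and col: "\<And>i. i < n \<Longrightarrow> col i < k"
    and w: "\<And>i. i < n \<Longrightarrow> 0 \<le> w i \<and> w i \<le> 1"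
    and peak: "\<And>c. c < k \<Longrightarrow> \<exists>i<n. col i = c \<and> w i = 1"
  shows "Max ((\<lambda>(i, j). w i * A $$ (i, j) * w j) ` {(i, j). i < n \<and> j < n \<and> col i = col j})
           \<in> max_numerical_range k A"
proof -
  have dim: "dim_row A = n" "dim_col A = n"
    and nonneg: "\<And>i j. i < n \<Longrightarrow> j < n \<Longrightarrow> 0 \<le> A $$ (i, j)"
    using A by (auto simp: nonneg_carrier_mat_def)
  have n: "0 < n" using peak[OF k] by auto
  then have ne: "{..<n} \<noteq> {}" by auto
  define X where "X = mat n k (\<lambda>(i, c). if col i = c then w i else 0)"
  have X: "X $$ (i, c) = (if col i = c then w i else 0)" if "i < n" "c < k" for i c
    using that by (simp add: X_def)
  have dX: "dim_row X = n" "dim_col X = k" by (auto simp: X_def)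
  have XN: "X \<in> nonneg_carrier_mat n k"
    using w by (auto simp: nonneg_carrier_mat_def X_def)
  have "max_mult (transpose_mat X) X = 1\<^sub>m k"
  proof (rule eq_matI)
    fix c d assume "c < dim_row (1\<^sub>m k :: real mat)" and "d < dim_col (1\<^sub>m k :: real mat)"
    then have cd: "c < k" "d < k" by auto
    obtain i0 where i0: "i0 < n" "col i0 = c" "w i0 = 1" using peak[OF cd(1)] by auto
    have "Max ((\<lambda>l. X $$ (l, c) * X $$ (l, d)) ` {..<n}) = (if c = d then 1 else 0)"
    proof (rule Max_eqI)
      show "finite ((\<lambda>l. X $$ (l, c) * X $$ (l, d)) ` {..<n})" by simp
      show "(if c = d then 1 else 0) \<in> (\<lambda>l. X $$ (l, c) * X $$ (l, d)) ` {..<n}"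
        using i0 cd by (intro image_eqI[of _ _ i0]) (auto simp: X)
      show "t \<le> (if c = d then 1 else 0)" if "t \<in> (\<lambda>l. X $$ (l, c) * X $$ (l, d)) ` {..<n}" for t
        using that cd w by (auto simp: X mult_le_one)
    qed
    then show "max_mult (transpose_mat X) X $$ (c, d) = 1\<^sub>m k $$ (c, d)"
      using cd dX by (simp add: max_mult_def)
  qed (auto simp: max_mult_def dX)
  moreover have "max_trace (max_mult (max_mult (transpose_mat X) A) X) =
     Max ((\<lambda>(i, j). w i * A $$ (i, j) * w j) ` {(i, j). i < n \<and> j < n \<and> col i = col j})"
    (is "_ = Max ?V")
  proof -
    have finV: "finite ?V"
      by (rule finite_imageI, rule finite_subset[of _ "{..<n} \<times> {..<n}"]) auto
    let ?B = "\<lambda>c j. Max ((\<lambda>l. X $$ (l, c) * A $$ (l, j)) ` {..<n})"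
    let ?G = "\<lambda>c. Max ((\<lambda>j. ?B c j * X $$ (j, c)) ` {..<n})"
    have tr: "max_trace (max_mult (max_mult (transpose_mat X) A) X) = Max (?G ` {..<k})"
      using dX dim by (simp add: max_trace_def max_mult_def cong: image_cong_simp)
    have VE: "w i * A $$ (i, j) * w j \<le> Max ?V" if "i < n" "j < n" "col i = col j" for i j
      using that finV by (intro Max_ge) auto
    have V0: "0 \<le> Max ?V"
      using VE[of 0 0] n nonneg w by (meson mult_nonneg_nonneg order_trans)
    have "Max (?G ` {..<k}) \<le> Max ?V"
    proof -
      have "?B c j * X $$ (j, c) \<le> Max ?V" if cj: "c < k" "j < n" for c j
      proof -
        have "?B c j \<in> (\<lambda>l. X $$ (l, c) * A $$ (l, j)) ` {..<n}" using ne by (intro Max_in) auto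
        then obtain i where i: "i < n" "?B c j = X $$ (i, c) * A $$ (i, j)" by auto
        then show ?thesis using cj V0 VE[of i j] by (auto simp: X)
      qed
      then have "?G c \<le> Max ?V" if "c < k" for c
        using that ne by (intro Max.boundedI) auto
      then show ?thesis using k by (intro Max.boundedI) auto
    qed
    moreover have "Max ?V \<le> Max (?G ` {..<k})"
    proof -
      have "w i * A $$ (i, j) * w j \<le> Max (?G ` {..<k})"
        if ij: "i < n" "j < n" "col i = col j" for i j
      proof -
        have c: "col i < k" "col j < k" using col ij by auto
        have "w i * A $$ (i, j) = X $$ (i, col j) * A $$ (i, j)" using ij c by (simp add: X)
        also have "\<dots> \<le> ?B (col j) j" using ij by (intro Max_ge) auto
        finally have "w i * A $$ (i, j) * w j \<le> ?B (col j) j * X $$ (j, col j)"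
          using w ij c by (simp add: X mult_right_mono)
        also have "\<dots> \<le> ?G (col j)" using ij by (intro Max_ge) auto
        also have "\<dots> \<le> Max (?G ` {..<k})" using c by (intro Max_ge) auto
        finally show ?thesis .
      qed
      moreover have "?V \<noteq> {}" using n by auto
      ultimately show ?thesis using finV by (auto simp: Max_le_iff)
    qed
    ultimately show ?thesis using tr by simp
  qed
  ultimately show ?thesis using XN dim by (force simp: max_numerical_range_def)
qed

lemma continuous_on_Max_image:
  fixes f :: "'i \<Rightarrow> 'a::topological_space \<Rightarrow> 'b::linorder_topology"
  assumes "finite I" and "I \<noteq> {}" and "\<And>i. i \<in> I \<Longrightarrow> continuous_on S (f i)"
  shows "continuous_on S (\<lambda>s. Max ((\<lambda>i. f i s) ` I))"
  using assms
proof (induction I rule: finite_ne_induct)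
  case (insert i I)
  then have "continuous_on S (\<lambda>s. max (f i s) (Max ((\<lambda>i. f i s) ` I)))"
    by (intro continuous_on_max) auto
  then show ?case using insert by simp
qed simp

text \<open>Give the rows of \<open>J\<close> distinct colours and weight 1, and all other rows the colour of
  \<open>j0\<close> and a common weight \<open>s\<close>. At \<open>s = 0\<close> only the diagonal entries in \<open>J\<close> count, so the
  trace is at most \<open>v\<close>. At \<open>s = 1\<close> every weight is 1, so the trace is at least
  \<open>A $$ (p, q)\<close>, because \<open>p\<close> and \<open>q\<close> have the same colour. The intermediate value theorem gives \<open>v\<close> itself.\<close>

lemma range_interpolation:
  assumes A: "A \<in> nonneg_carrier_mat n n"
    and J: "J \<subseteq> {..<n}" "card J = k" and j0: "j0 \<in> J"
    and lower: "\<And>j. j \<in> J \<Longrightarrow> A $$ (j, j) \<le> v"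
    and pq: "p < n" "q < n" "p = q \<or> {p, q} \<inter> J \<subseteq> {j0}" and upper: "v \<le> A $$ (p, q)"
  shows "v \<in> max_numerical_range k A"
proof -
  have nonneg: "\<And>i j. i < n \<Longrightarrow> j < n \<Longrightarrow> 0 \<le> A $$ (i, j)"
    using A by (auto simp: nonneg_carrier_mat_def)
  have finJ: "finite J" using J(1) by (rule finite_subset) simp
  have k: "0 < k" using J j0 finJ by (auto simp: card_gt_0_iff)
  obtain b where b: "bij_betw b J {..<k}"
    using finJ J(2) by (metis ex_bij_betw_finite_nat atLeast0LessThan)
  define col where "col i = b (if i \<in> J then i else j0)" for i
  define w where "w s i = (if i \<in> J then 1 else s)" for s :: real and i
  define T where "T = {(i, j). i < n \<and> j < n \<and> col i = col j}"
  define g where "g s = Max ((\<lambda>(i, j). w s i * A $$ (i, j) * w s j) ` T)" for s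
  have finT: "finite T" unfolding T_def by (rule finite_subset[of _ "{..<n} \<times> {..<n}"]) auto
  have pqT: "(p, q) \<in> T" using pq by (auto simp: T_def col_def)
  have colk: "col i < k" for i using b j0 by (auto simp: col_def bij_betw_def)
  have range: "g s \<in> max_numerical_range k A" if "0 \<le> s" "s \<le> 1" for s
    unfolding g_def T_def
  proof (rule coloured_weights_in_range[OF A k])
    fix c assume "c < k"
    then have "c \<in> b ` J" using b by (simp add: bij_betw_def)
    then obtain i where "i \<in> J" "b i = c" by auto
    then show "\<exists>i<n. col i = c \<and> w s i = 1" using J(1) by (auto simp: col_def w_def)
  qed (use that colk in \<open>auto simp: w_def\<close>)
  have "continuous_on {0..1} g"
    unfolding g_def
  proof (rule continuous_on_Max_image[OF finT])
    show "T \<noteq> {}" using pqT by auto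
    show "continuous_on {0..1} (\<lambda>s. case t of (i, j) \<Rightarrow> w s i * A $$ (i, j) * w s j)" for t
      by (cases t; cases "fst t \<in> J"; cases "snd t \<in> J") (auto simp: w_def intro!: continuous_intros)
  qed
  moreover have "g 0 \<le> v"
  proof -
    have v0: "0 \<le> v" using lower[OF j0] nonneg[of j0 j0] j0 J(1) by auto
    have "w 0 i * A $$ (i, j) * w 0 j \<le> v" if "(i, j) \<in> T" for i j
    proof (cases "i \<in> J \<and> j \<in> J")
      case True
      then have "i = j" using that b by (auto simp: T_def col_def bij_betw_def inj_on_def)
      then show ?thesis using True lower by (simp add: w_def)
    next
      case False
      then show ?thesis using v0 by (auto simp: w_def)
    qed
    moreover have "T \<noteq> {}" using pqT by auto
    ultimately show ?thesis unfolding g_def using finT by (auto simp: Max_le_iff)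
  qed
  moreover have "v \<le> g 1"
  proof -
    have "w 1 p * A $$ (p, q) * w 1 q \<le> g 1"
      unfolding g_def using finT pqT by (intro Max_ge) auto
    then show ?thesis using upper by (simp add: w_def)
  qed
  ultimately obtain s where "0 \<le> s" "s \<le> 1" "g s = v"
    using IVT'[of g 0 v 1] by auto
  then show ?thesis using range by blast
qed

text \<open>The interpolation fails to cover only a large entry in two different rows \<open>p\<close> and \<open>q\<close> of
  \<open>J\<close>. Then let \<open>r\<close> be a row outside \<open>J\<close>, which exists as \<open>k < n\<close>. Either its diagonal entry
  is large, and can replace \<open>A $$ (p, q)\<close>, or it is small, and \<open>r\<close> can replace \<open>q\<close> in \<open>J\<close>.\<close>

lemma between_diagonal_and_entry_in_range:
  assumes A: "A \<in> nonneg_carrier_mat n n" and k: "1 \<le> k" "k < n"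
    and J: "J \<subseteq> {..<n}" "card J = k" and lower: "\<And>j. j \<in> J \<Longrightarrow> A $$ (j, j) \<le> v"
    and pq: "p < n" "q < n" and upper: "v \<le> A $$ (p, q)"
  shows "v \<in> max_numerical_range k A"
proof (cases "p \<in> J \<and> q \<in> J \<and> p \<noteq> q")
  case False
  then obtain j0 where "j0 \<in> J" "p = q \<or> {p, q} \<inter> J \<subseteq> {j0}"
    using J k by (cases "p \<in> J"; cases "q \<in> J") fastforce+
  then show ?thesis using range_interpolation[OF A J _ lower pq _ upper] by blast
next
  case True
  obtain r where r: "r < n" "r \<notin> J"
    using J k by (metis card_lessThan lessThan_iff nless_le subset_antisym subsetI)
  show ?thesis
  proof (cases "v \<le> A $$ (r, r)")
    case r_large: True
    then show ?thesis using range_interpolation[OF A J _ lower r(1) r(1) _ r_large] True by blast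
  next
    case False
    have finJ: "finite J" using J(1) by (rule finite_subset) simp
    let ?J = "insert r (J - {q})"
    have "card ?J = k" using finJ r True J k by (simp add: card_Diff_singleton)
    moreover have "?J \<subseteq> {..<n}" using J r by auto
    moreover have "p \<in> ?J" and "{p, q} \<inter> ?J \<subseteq> {p}" using True r by auto
    moreover have "A $$ (j, j) \<le> v" if "j \<in> ?J" for j using that lower False by auto
    ultimately show ?thesis using range_interpolation[OF A _ _ _ _ pq _ upper, of ?J k p] by blast
  qed
qed

section \<open>The inclusion\<close>

text \<open>The lower point carries the coefficient 1, the upper point attains the maximum with a
  coefficient at most 1.\<close>

lemma max_conv_between:
  assumes "v \<in> max_conv M" and "\<And>x. x \<in> M \<Longrightarrow> 0 \<le> x"
  obtains a b where "a \<in> M" and "b \<in> M" and "a \<le> v" and "v \<le> b"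
proof -
  obtain m :: nat and \<alpha> x where m: "0 < m" and v: "v = Max ((\<lambda>i. \<alpha> i * x i) ` {..<m})"
    and \<alpha>x: "\<And>i. i < m \<Longrightarrow> x i \<in> M \<and> 0 \<le> \<alpha> i" and \<alpha>: "Max (\<alpha> ` {..<m}) = 1"
    using assms(1) by (auto simp: max_conv_def)
  have ne: "{..<m} \<noteq> {}" using m by auto
  have "Max (\<alpha> ` {..<m}) \<in> \<alpha> ` {..<m}" using ne by (intro Max_in) auto
  then obtain i where i: "i < m" "\<alpha> i = 1" using \<alpha> by auto
  have "\<alpha> i * x i \<le> v" unfolding v using i(1) by (intro Max_ge) auto
  then have "x i \<le> v" using i by simp
  moreover have "v \<in> (\<lambda>i. \<alpha> i * x i) ` {..<m}" unfolding v using ne by (intro Max_in) auto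
  then obtain j where j: "j < m" "v = \<alpha> j * x j" by auto
  have "\<alpha> j \<le> 1" unfolding \<alpha>[symmetric] using j by (intro Max_ge) auto
  then have "v \<le> x j" using j \<alpha>x[of j] assms(2)[of "x j"] by (simp add: mult_left_le_one_le)
  ultimately show thesis using that i j \<alpha>x by blast
qed

theorem theorem3p27:
  fixes A :: "real mat" and n k :: nat
  assumes "A \<in> nonneg_carrier_mat n n"
    and "1 \<le> k" and "k < n"
  shows "max_conv (trop_spectrum k A) \<subseteq> max_numerical_range k A"
proof
  fix v assume v: "v \<in> max_conv (trop_spectrum k A)"
  let ?l = "\<lambda>i. trop_eigenvalues A ! i"
  have dim: "dim_row A = n" using assms(1) by (auto simp: nonneg_carrier_mat_def)
  have len: "length (trop_eigenvalues A) = n"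
    and pos: "\<And>l. l \<in> set (trop_eigenvalues A) \<Longrightarrow> 0 \<le> l"
    using trop_eigenvalues_spec[OF assms(1)] by auto
  have spectrum: "\<exists>I. I \<subseteq> {..<n} \<and> card I = k \<and> (\<forall>i\<in>I. ?l i \<le> x) \<and> x \<in> ?l ` I"
    if x: "x \<in> trop_spectrum k A" for x
  proof -
    obtain I where I: "I \<subseteq> {..<n}" "card I = k" "x = Max (?l ` I)"
      using x dim by (auto simp: trop_spectrum_def)
    then have "finite I" and "I \<noteq> {}" using assms(2) by (auto intro: finite_subset)
    then show ?thesis using I Max_in[of "?l ` I"] by (intro exI[of _ I]) auto
  qed
  have eigen: "x \<in> set (trop_eigenvalues A)" if "x \<in> trop_spectrum k A" for x
    using spectrum[OF that] len by (auto simp: set_conv_nth)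
  obtain a b where ab: "a \<in> trop_spectrum k A" "b \<in> trop_spectrum k A" "a \<le> v" "v \<le> b"
    using max_conv_between[OF v] eigen pos by blast
  obtain I where I: "I \<subseteq> {..<n}" "card I = k" "\<And>i. i \<in> I \<Longrightarrow> ?l i \<le> a"
    using spectrum[OF ab(1)] by blast
  have "0 \<le> v" using pos eigen ab by force
  have "k = card I" using I by simp
  also have "\<dots> \<le> card {i. i < n \<and> ?l i \<le> v}"
    using I ab(3) by (intro card_mono) force+
  also have "\<dots> \<le> card {i. i < n \<and> A $$ (i, i) \<le> v}"
    using card_eigenvalues_le_card_diagonal[OF assms(1) \<open>0 \<le> v\<close>] .
  finally obtain J where J: "J \<subseteq> {i. i < n \<and> A $$ (i, i) \<le> v}" "card J = k"
    by (rule obtain_subset_with_card_n)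
  obtain p q where pq: "p < n" "q < n" "b \<le> A $$ (p, q)"
    using eigenvalue_le_some_entry[OF assms(1) eigen[OF ab(2)]] .
  show "v \<in> max_numerical_range k A"
    using J pq ab(4)
    by (intro between_diagonal_and_entry_in_range[OF assms, of J v p q]) auto
qed

end
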